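(* Let $G$ be a virtually free group. If $G$ is subgroup into-conjugacy separable, then $G$ is subgroup conjugacy separable.
   Context: For two subgroups $A,B$ of a group $G$, $A$ is said to be conjugate into $B$ (in $G$) if there is $g\in G$ such that $A^g$ is a subgroup of $B$, where $A^g$ denotes the conjugate of $A$ by $g$. A group $G$ is subgroup into-conjugacy separable (SICS) if for any two finitely generated subgroups $H_1,H_2\leqslant G$ such that $H_2$ is not conjugate into $H_1$, there exists a homomorphism $\phi$ from $G$ to a finite group $\overline{G}$ such that $\phi(H_2)$ is not conjugate into $\phi(H_1)$ in $\overline{G}$. A group $G$ is subgroup conjugacy separable (SCS) if for any two finitely generated non-conjugate subgroups $H_1,H_2\leqslant G$ there exists a homomorphism $\phi$ from $G$ to a finite group $\overline{G}$ such that $\phi(H_1)$ is not conjugate to $\phi(H_2)$ in $\overline{G}$. A group is virtually free if it has a free subgroup of finite index; it is not assumed finitely generated. *)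

theory Defs
  imports "HOL-Algebra.Algebra"
begin

section \<open>Conjugate subgroups\<close>

text \<open>The conjugate \<open>A\<^sup>g = g\<^sup>-\<^sup>1 A g\<close>.\<close>

definition conjugate_set :: "('a, 'b) monoid_scheme \<Rightarrow> 'a set \<Rightarrow> 'a \<Rightarrow> 'a set" where
  "conjugate_set G A g = inv\<^bsub>G\<^esub> g <#\<^bsub>G\<^esub> (A #>\<^bsub>G\<^esub> g)"

definition conjugate_into :: "('a, 'b) monoid_scheme \<Rightarrow> 'a set \<Rightarrow> 'a set \<Rightarrow> bool" where
  "conjugate_into G A B \<longleftrightarrow> (\<exists>g\<in>carrier G. conjugate_set G A g \<subseteq> B)"

definition conjugate_in :: "('a, 'b) monoid_scheme \<Rightarrow> 'a set \<Rightarrow> 'a set \<Rightarrow> bool" where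
  "conjugate_in G A B \<longleftrightarrow> (\<exists>g\<in>carrier G. conjugate_set G A g = B)"

definition fg_subgroup :: "'a set \<Rightarrow> ('a, 'b) monoid_scheme \<Rightarrow> bool" where
  "fg_subgroup H G \<longleftrightarrow> subgroup H G \<and> (\<exists>S\<subseteq>carrier G. finite S \<and> H = generate G S)"


section \<open>Separability by finite quotients\<close>

text \<open>
  The finite groups in the next two definitions have elements of type \<^typ>\<open>nat\<close>, because a
  definition cannot quantify over types. Nothing is lost: by \<open>separated_nat\<close> below, a separating
  homomorphism to a finite group over any type yields one to a finite group over \<^typ>\<open>nat\<close>.
\<close>

definition SICS :: "('a, 'b) monoid_scheme \<Rightarrow> bool" where
  "SICS G \<longleftrightarrow>
     (\<forall>H1 H2. fg_subgroup H1 G \<longrightarrow> fg_subgroup H2 G \<longrightarrow> \<not> conjugate_into G H2 H1 \<longrightarrow>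
       (\<exists>(Q :: nat monoid) \<phi>. group Q \<and> finite (carrier Q) \<and> \<phi> \<in> hom G Q \<and>
          \<not> conjugate_into Q (\<phi> ` H2) (\<phi> ` H1)))"

definition SCS :: "('a, 'b) monoid_scheme \<Rightarrow> bool" where
  "SCS G \<longleftrightarrow>
     (\<forall>H1 H2. fg_subgroup H1 G \<longrightarrow> fg_subgroup H2 G \<longrightarrow> \<not> conjugate_in G H1 H2 \<longrightarrow>
       (\<exists>(Q :: nat monoid) \<phi>. group Q \<and> finite (carrier Q) \<and> \<phi> \<in> hom G Q \<and>
          \<not> conjugate_in Q (\<phi> ` H1) (\<phi> ` H2)))"

lemma finite_group_nat_copy:
  fixes K :: "('c, 'd) monoid_scheme"
  assumes "group K" "finite (carrier K)"
  obtains Q :: "nat monoid" and f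
  where "group Q" "finite (carrier Q)" "f \<in> hom K Q" "f ` carrier K = carrier Q"
    "inj_on f (carrier K)"
proof -
  interpret K: group K by fact
  obtain f :: "'c \<Rightarrow> nat" where f: "inj_on f (carrier K)"
    using finite_imp_inj_to_nat_seg[OF assms(2)] by blast
  let ?g = "inv_into (carrier K) f"
  define Q :: "nat monoid" where
    "Q = \<lparr>carrier = f ` carrier K, monoid.mult = (\<lambda>a b. f (?g a \<otimes>\<^bsub>K\<^esub> ?g b)), one = f \<one>\<^bsub>K\<^esub>\<rparr>"
  have hom: "f \<in> hom K Q"
    using f by (auto simp: hom_def Q_def)
  have car: "carrier Q = f ` carrier K" and one: "\<one>\<^bsub>Q\<^esub> = f \<one>\<^bsub>K\<^esub>"
    by (simp_all add: Q_def)
  have mult: "f a \<otimes>\<^bsub>Q\<^esub> f b = f (a \<otimes>\<^bsub>K\<^esub> b)" if "a \<in> carrier K" "b \<in> carrier K" for a b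
    using that f by (simp add: Q_def)
  have "group Q"
  proof (rule groupI)
    show "x \<otimes>\<^bsub>Q\<^esub> y \<in> carrier Q" if "x \<in> carrier Q" "y \<in> carrier Q" for x y
      using that unfolding car by (auto simp: mult)
    show "\<one>\<^bsub>Q\<^esub> \<in> carrier Q"
      unfolding car one by simp
    show "x \<otimes>\<^bsub>Q\<^esub> y \<otimes>\<^bsub>Q\<^esub> z = x \<otimes>\<^bsub>Q\<^esub> (y \<otimes>\<^bsub>Q\<^esub> z)"
      if "x \<in> carrier Q" "y \<in> carrier Q" "z \<in> carrier Q" for x y z
      using that unfolding car by (auto simp: mult K.m_assoc)
    show "\<one>\<^bsub>Q\<^esub> \<otimes>\<^bsub>Q\<^esub> x = x" if "x \<in> carrier Q" for x
      using that unfolding car one by (auto simp: mult)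
    show "\<exists>y\<in>carrier Q. y \<otimes>\<^bsub>Q\<^esub> x = \<one>\<^bsub>Q\<^esub>" if "x \<in> carrier Q" for x
    proof -
      obtain a where "a \<in> carrier K" "x = f a"
        using \<open>x \<in> carrier Q\<close> unfolding car by blast
      then show ?thesis
        unfolding car one by (intro bexI[of _ "f (inv\<^bsub>K\<^esub> a)"]) (simp_all add: mult)
    qed
  qed
  moreover have "finite (carrier Q)"
    unfolding car using assms(2) by (rule finite_imageI)
  ultimately show ?thesis
    using hom car[symmetric] f by (rule that)
qed

lemma conjugate_set_eq:
  "conjugate_set G A g = (\<lambda>a. inv\<^bsub>G\<^esub> g \<otimes>\<^bsub>G\<^esub> (a \<otimes>\<^bsub>G\<^esub> g)) ` A"
  by (auto simp: conjugate_set_def l_coset_def r_coset_def)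

lemma conjugate_set_hom:
  assumes "group K" "group Q" "f \<in> hom K Q" "A \<subseteq> carrier K" "g \<in> carrier K"
  shows "conjugate_set Q (f ` A) (f g) = f ` conjugate_set K A g"
proof -
  interpret group_hom K Q f
    using assms(1-3) by (simp add: group_hom_def group_hom_axioms_def)
  have "f (inv\<^bsub>K\<^esub> g \<otimes>\<^bsub>K\<^esub> (a \<otimes>\<^bsub>K\<^esub> g)) = inv\<^bsub>Q\<^esub> f g \<otimes>\<^bsub>Q\<^esub> (f a \<otimes>\<^bsub>Q\<^esub> f g)" if "a \<in> A" for a
    using that assms(4,5) by (simp add: subset_iff)
  then show ?thesis
    unfolding conjugate_set_eq image_image by (intro image_cong) simp_all
qed

lemma conjugate_set_closed:
  assumes "group K" "A \<subseteq> carrier K" "g \<in> carrier K"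
  shows "conjugate_set K A g \<subseteq> carrier K"
proof -
  interpret group K by fact
  show ?thesis
    using assms(2,3) by (auto simp: conjugate_set_def l_coset_def r_coset_def)
qed

lemma conjugate_nat_copy:
  assumes "group K" "group Q" "f \<in> hom K Q" "f ` carrier K = carrier Q" "inj_on f (carrier K)"
    and "A \<subseteq> carrier K" "B \<subseteq> carrier K"
  shows "conjugate_into Q (f ` A) (f ` B) \<longleftrightarrow> conjugate_into K A B"
    and "conjugate_in Q (f ` A) (f ` B) \<longleftrightarrow> conjugate_in K A B"
proof -
  have eq: "conjugate_set Q (f ` A) (f g) \<subseteq> f ` B \<longleftrightarrow> conjugate_set K A g \<subseteq> B"
      "conjugate_set Q (f ` A) (f g) = f ` B \<longleftrightarrow> conjugate_set K A g = B"
    if g: "g \<in> carrier K" for g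
  proof -
    note cl = conjugate_set_closed[OF assms(1,6) g]
    show "conjugate_set Q (f ` A) (f g) \<subseteq> f ` B \<longleftrightarrow> conjugate_set K A g \<subseteq> B"
      unfolding conjugate_set_hom[OF assms(1-3,6) g]
      using inj_on_image_mem_iff[OF assms(5) _ assms(7)] cl by blast
    show "conjugate_set Q (f ` A) (f g) = f ` B \<longleftrightarrow> conjugate_set K A g = B"
      unfolding conjugate_set_hom[OF assms(1-3,6) g]
      by (rule inj_on_image_eq_iff[OF assms(5) cl assms(7)])
  qed
  show "conjugate_into Q (f ` A) (f ` B) \<longleftrightarrow> conjugate_into K A B"
    unfolding conjugate_into_def assms(4)[symmetric] bex_simps(7) by (simp add: eq(1))
  show "conjugate_in Q (f ` A) (f ` B) \<longleftrightarrow> conjugate_in K A B"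
    unfolding conjugate_in_def assms(4)[symmetric] bex_simps(7) by (simp add: eq(2))
qed

lemma separated_nat:
  fixes K :: "('c, 'd) monoid_scheme"
  assumes "group K" "finite (carrier K)" "\<phi> \<in> hom G K" "A \<subseteq> carrier G" "B \<subseteq> carrier G"
  shows conjugate_into_separated_nat: "\<not> conjugate_into K (\<phi> ` A) (\<phi> ` B) \<Longrightarrow>
      \<exists>(Q :: nat monoid) \<psi>. group Q \<and> finite (carrier Q) \<and> \<psi> \<in> hom G Q \<and>
        \<not> conjugate_into Q (\<psi> ` A) (\<psi> ` B)"
    and conjugate_in_separated_nat: "\<not> conjugate_in K (\<phi> ` A) (\<phi> ` B) \<Longrightarrow>
      \<exists>(Q :: nat monoid) \<psi>. group Q \<and> finite (carrier Q) \<and> \<psi> \<in> hom G Q \<and>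
        \<not> conjugate_in Q (\<psi> ` A) (\<psi> ` B)"
proof -
  obtain Q :: "nat monoid" and f
    where Q: "group Q" "finite (carrier Q)" "f \<in> hom K Q" "f ` carrier K = carrier Q"
      "inj_on f (carrier K)"
    using finite_group_nat_copy[OF assms(1,2)] .
  have "\<phi> ` A \<subseteq> carrier K" "\<phi> ` B \<subseteq> carrier K"
    using assms(3-5) by (auto simp: hom_def)
  note eq = conjugate_nat_copy[OF assms(1) Q(1,3,4,5) this, unfolded image_comp]
  have hom: "f \<circ> \<phi> \<in> hom G Q"
    using assms(3) Q(3) by (rule hom_compose)
  show "\<exists>(Q :: nat monoid) \<psi>. group Q \<and> finite (carrier Q) \<and> \<psi> \<in> hom G Q \<and>
      \<not> conjugate_into Q (\<psi> ` A) (\<psi> ` B)" if "\<not> conjugate_into K (\<phi> ` A) (\<phi> ` B)"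
    using that eq(1) Q(1,2) hom by blast
  show "\<exists>(Q :: nat monoid) \<psi>. group Q \<and> finite (carrier Q) \<and> \<psi> \<in> hom G Q \<and>
      \<not> conjugate_in Q (\<psi> ` A) (\<psi> ` B)" if "\<not> conjugate_in K (\<phi> ` A) (\<phi> ` B)"
    using that eq(2) Q(1,2) hom by blast
qed


section \<open>Virtually free groups\<close>

text \<open>
  A letter \<open>(x, True)\<close> stands for \<open>x\<close> and \<open>(x, False)\<close> for its formal inverse.
\<close>

fun letter_value :: "('a, 'b) monoid_scheme \<Rightarrow> 'a \<times> bool \<Rightarrow> 'a" where
  "letter_value G (x, b) = (if b then x else inv\<^bsub>G\<^esub> x)"

definition word_value :: "('a, 'b) monoid_scheme \<Rightarrow> ('a \<times> bool) list \<Rightarrow> 'a" where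
  "word_value G w = foldr (\<lambda>l y. letter_value G l \<otimes>\<^bsub>G\<^esub> y) w \<one>\<^bsub>G\<^esub>"

definition reduced_words :: "'a set \<Rightarrow> ('a \<times> bool) list set" where
  "reduced_words S =
     {w. set w \<subseteq> S \<times> UNIV \<and> successively (\<lambda>l k. \<not> (fst l = fst k \<and> snd l \<noteq> snd k)) w}"

text \<open>
  \<open>S\<close> is a basis if every element is the value of exactly one reduced word over \<open>S\<close>, that is, if
  the canonical map from the group of reduced words on \<open>S\<close> is an isomorphism. Bases may be
  empty or infinite.
\<close>

definition free_basis :: "('a, 'b) monoid_scheme \<Rightarrow> 'a set \<Rightarrow> bool" where
  "free_basis G S \<longleftrightarrow>
     S \<subseteq> carrier G \<and> bij_betw (word_value G) (reduced_words S) (carrier G)"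

definition free_group :: "('a, 'b) monoid_scheme \<Rightarrow> bool" where
  "free_group G \<longleftrightarrow> group G \<and> (\<exists>S. free_basis G S)"

definition virtually_free :: "('a, 'b) monoid_scheme \<Rightarrow> bool" where
  "virtually_free G \<longleftrightarrow>
     (\<exists>F. subgroup F G \<and> finite (rcosets\<^bsub>G\<^esub> F) \<and> free_group (G\<lparr>carrier := F\<rparr>))"

end

theory Submission
  imports Defs "HOL-Combinatorics.Permutations" "HOL-Library.Sublist"
begin

text \<open>
  If neither of \<open>H\<^sub>1\<close>, \<open>H\<^sub>2\<close> can be separated from being conjugate into the other, then
  \<open>H\<^sub>1\<^sup>g \<le> H\<^sub>2\<close> and \<open>H\<^sub>2\<^sup>h \<le> H\<^sub>1\<close>, and it suffices that in a virtually free group a finitely generated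
  \<open>H\<close> with \<open>H\<^sup>c \<le> H\<close> satisfies \<open>H\<^sup>c = H\<close>. Some power \<open>t = c\<^sup>n\<close> lies in the free subgroup \<open>F\<close> of finite
  index, and \<open>K = H \<inter> F\<close> is finitely generated with \<open>K\<^sup>t \<le> K\<close>. By M. Hall's theorem \<open>K\<close> is separable
  in \<open>F\<close>; since a finite group has no subset conjugate into itself properly, \<open>K\<^sup>t = K\<close>. As \<open>K\<close> has
  finite index in \<open>H\<close>, this gives \<open>H\<^sup>t = H\<close>, and \<open>H\<^sup>t \<le> H\<^sup>c \<le> H\<close>.
\<close>

section \<open>The universal property of a free basis\<close>

lemma word_value_Nil [simp]: "word_value G [] = \<one>\<^bsub>G\<^esub>"
  by (simp add: word_value_def)

lemma word_value_Cons [simp]: "word_value G (l # w) = letter_value G l \<otimes>\<^bsub>G\<^esub> word_value G w"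
  by (simp add: word_value_def)

lemma (in group) letter_value_closed [simp]:
  "fst l \<in> carrier G \<Longrightarrow> letter_value G l \<in> carrier G"
  by (cases l) simp

lemma (in group) word_value_closed [simp]:
  "fst ` set w \<subseteq> carrier G \<Longrightarrow> word_value G w \<in> carrier G"
  by (induction w) auto

lemma (in group) word_value_append:
  "fst ` set v \<subseteq> carrier G \<Longrightarrow> fst ` set w \<subseteq> carrier G \<Longrightarrow>
    word_value G (v @ w) = word_value G v \<otimes> word_value G w"
  by (induction v) (auto simp: m_assoc)

abbreviation map_word :: "('a \<Rightarrow> 'b) \<Rightarrow> ('a \<times> bool) list \<Rightarrow> ('b \<times> bool) list" where
  "map_word f \<equiv> map (apfst f)"

lemma (in group) mult_inv_cancel_left:
  assumes "x \<in> carrier G" "y \<in> carrier G"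
  shows "inv x \<otimes> (x \<otimes> y) = y" and "x \<otimes> (inv x \<otimes> y) = y"
  using assms by (simp_all add: m_assoc[symmetric])

lemma (in group) letter_value_cancel:
  assumes "fst l \<in> carrier G" "y \<in> carrier G" "fst k = fst l" "snd k \<noteq> snd l"
  shows "letter_value G l \<otimes> (letter_value G k \<otimes> y) = y"
  using assms by (cases l; cases k) (auto simp: m_assoc[symmetric])

text \<open>Free reduction, built up from the right: a new letter either cancels against the head of
  the reduced tail or extends it. Cancelling is legitimate in every group, so the same reduction
  preserves the value in \<open>F\<close> and, after relabelling by \<open>f\<close>, the value in
  \<open>Q\<close>. This is what makes the map in \<open>free_basis_hom\<close> independent of the
  chosen word.\<close>

lemma word_reduction:
  assumes "group F" "group Q" "S \<subseteq> carrier F" "f ` S \<subseteq> carrier Q" "set w \<subseteq> S \<times> UNIV"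
  shows "\<exists>v\<in>reduced_words S. word_value F v = word_value F w \<and>
    word_value Q (map_word f v) = word_value Q (map_word f w)"
  using assms(5)
proof (induction w)
  case Nil
  then show ?case by (intro bexI[of _ "[]"]) (auto simp: reduced_words_def)
next
  case (Cons l w)
  interpret F: group F by fact
  interpret Q: group Q by fact
  from Cons obtain v where v: "v \<in> reduced_words S" "word_value F v = word_value F w"
    "word_value Q (map_word f v) = word_value Q (map_word f w)" by fastforce
  have l: "fst l \<in> S" using Cons.prems by auto
  show ?case
  proof (cases "\<exists>k u. v = k # u \<and> fst l = fst k \<and> snd l \<noteq> snd k")
    case True
    then obtain k u where ku: "v = k # u" "fst l = fst k" "snd l \<noteq> snd k" by blast
    have u: "u \<in> reduced_words S"
      using v(1) ku(1) by (auto simp: reduced_words_def successively_Cons)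
    have uF: "word_value F u \<in> carrier F" "word_value Q (map_word f u) \<in> carrier Q"
    proof -
      have "set u \<subseteq> S \<times> UNIV" using u by (simp add: reduced_words_def)
      then have "fst ` set u \<subseteq> S" by auto
      then have "fst ` set u \<subseteq> carrier F" "fst ` set (map_word f u) \<subseteq> carrier Q"
        using assms(3,4) by fastforce+
      then show "word_value F u \<in> carrier F" "word_value Q (map_word f u) \<in> carrier Q"
        by (simp_all only: F.word_value_closed Q.word_value_closed)
    qed
    have "word_value F (l # w) = letter_value F l \<otimes>\<^bsub>F\<^esub> (letter_value F k \<otimes>\<^bsub>F\<^esub> word_value F u)"
      using v(2) by (simp add: ku(1))
    also have "\<dots> = word_value F u"
      by (rule F.letter_value_cancel) (use l assms(3) ku(2,3) uF in auto)
    finally have "word_value F (l # w) = word_value F u" .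
    moreover have "word_value Q (map_word f (l # w)) =
        letter_value Q (apfst f l) \<otimes>\<^bsub>Q\<^esub> (letter_value Q (apfst f k) \<otimes>\<^bsub>Q\<^esub> word_value Q (map_word f u))"
      using v(3) by (simp add: ku(1))
    moreover have "\<dots> = word_value Q (map_word f u)"
      by (rule Q.letter_value_cancel) (use l assms(4) ku(2,3) uF in auto)
    ultimately show ?thesis using u by (intro bexI[of _ u]) simp_all
  next
    case False
    then have "l # v \<in> reduced_words S"
      using v(1) l Cons.prems by (cases v) (auto simp: reduced_words_def)
    then show ?thesis using v(2,3) by (intro bexI[of _ "l # v"]) auto
  qed
qed

lemma free_basis_hom:
  assumes "group F" "free_basis F S" "group Q" "f ` S \<subseteq> carrier Q"
  obtains \<phi> where "\<phi> \<in> hom F Q" "\<And>s. s \<in> S \<Longrightarrow> \<phi> s = f s"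
proof -
  interpret F: group F by fact
  interpret Q: group Q by fact
  have S: "S \<subseteq> carrier F" and bij: "bij_betw (word_value F) (reduced_words S) (carrier F)"
    using assms(2) by (auto simp: free_basis_def)
  define r where "r = inv_into (reduced_words S) (word_value F)"
  define \<phi> where "\<phi> = (\<lambda>x. word_value Q (map_word f (r x)))"
  have r: "r x \<in> reduced_words S" "word_value F (r x) = x" if "x \<in> carrier F" for x
    using that bij by (auto simp: r_def bij_betw_def inv_into_into f_inv_into_f)
  have rS: "set (r x) \<subseteq> S \<times> UNIV" if "x \<in> carrier F" for x
    using r(1)[OF that] by (simp add: reduced_words_def)
  \<comment> \<open>Arbitrary words must be covered here, since the concatenation
    \<open>r x @ r y\<close> used for multiplicativity may fail to be reduced.\<close>
  have \<phi>: "\<phi> (word_value F w) = word_value Q (map_word f w)" if "set w \<subseteq> S \<times> UNIV" for w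
  proof -
    obtain v where v: "v \<in> reduced_words S" "word_value F v = word_value F w"
      "word_value Q (map_word f v) = word_value Q (map_word f w)"
      using word_reduction[OF assms(1,3) S assms(4) \<open>set w \<subseteq> S \<times> UNIV\<close>] by blast
    have "r (word_value F v) = v"
      using bij v(1) by (simp add: r_def bij_betw_def)
    then show ?thesis using v by (simp add: \<phi>_def)
  qed
  have inF: "fst ` set w \<subseteq> carrier F" and inQ: "fst ` set (map_word f w) \<subseteq> carrier Q"
    if "set w \<subseteq> S \<times> UNIV" for w
    using that S assms(4) by fastforce+
  have "\<phi> \<in> hom F Q"
  proof (rule homI)
    fix x y assume x: "x \<in> carrier F" and y: "y \<in> carrier F"
    show "\<phi> x \<in> carrier Q"
      unfolding \<phi>_def using inQ[OF rS[OF x]] by (rule Q.word_value_closed)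
    have "\<phi> (word_value F (r x @ r y)) = word_value Q (map_word f (r x @ r y))"
      using rS[OF x] rS[OF y] by (intro \<phi>) auto
    then show "\<phi> (x \<otimes>\<^bsub>F\<^esub> y) = \<phi> x \<otimes>\<^bsub>Q\<^esub> \<phi> y"
      using Q.word_value_append[OF inQ[OF rS[OF x]] inQ[OF rS[OF y]]]
        F.word_value_append[OF inF[OF rS[OF x]] inF[OF rS[OF y]]] r x y
      by (simp add: \<phi>_def)
  qed
  moreover have "\<phi> s = f s" if "s \<in> S" for s
    using \<phi>[of "[(s, True)]"] that S assms(4) by (auto simp: image_subset_iff subset_iff)
  ultimately show ?thesis by (rule that)
qed


section \<open>Finitely generated subgroups of free groups are separable\<close>

text \<open>\<open>A\<close> and its image have the same size, hence so do their complements in the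
  finite set \<open>P\<close>; any bijection between the complements completes
  \<open>f\<close>.\<close>

lemma partial_injection_extends_to_permutation:
  assumes "finite P" "A \<subseteq> P" "f ` A \<subseteq> P" "inj_on f A"
  obtains p where "p permutes P" "\<And>a. a \<in> A \<Longrightarrow> p a = f a"
proof -
  have "card (P - A) = card (P - f ` A)"
    using assms by (simp add: card_Diff_subset finite_subset card_image)
  then obtain h where h: "bij_betw h (P - A) (P - f ` A)"
    using assms(1) finite_same_card_bij[of "P - A" "P - f ` A"] by auto
  define p where "p = (\<lambda>x. if x \<in> A then f x else if x \<in> P then h x else x)"
  have "bij_betw p A (f ` A)"
    using assms(4) by (auto simp: bij_betw_def p_def inj_on_def)
  moreover have "bij_betw p (P - A) (P - f ` A)"
    using h by (rule bij_betw_cong[THEN iffD1, rotated]) (simp add: p_def)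
  ultimately have "bij_betw p (A \<union> (P - A)) (f ` A \<union> (P - f ` A))"
    by (rule bij_betw_combine) blast
  then have "bij_betw p P P"
    using assms(2,3) by (simp add: Un_absorb1)
  then have "p permutes P"
    using assms(2) by (rule_tac bij_imp_permutes) (auto simp: p_def)
  then show ?thesis by (rule that) (simp add: p_def)
qed

text \<open>With composition as product, a homomorphism into this group is a left action on
  \<open>P\<close>, which suits left cosets.\<close>

definition permutation_group :: "'a set \<Rightarrow> ('a \<Rightarrow> 'a) monoid" where
  "permutation_group P = \<lparr>carrier = {p. p permutes P}, monoid.mult = (\<circ>), one = id\<rparr>"

lemma permutation_group_simps [simp]:
  "p \<in> carrier (permutation_group P) \<longleftrightarrow> p permutes P"
  "p \<otimes>\<^bsub>permutation_group P\<^esub> q = p \<circ> q"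
  "\<one>\<^bsub>permutation_group P\<^esub> = id"
  by (simp_all add: permutation_group_def)

lemma group_permutation_group: "group (permutation_group P)"
proof (rule groupI)
  show "\<exists>q\<in>carrier (permutation_group P). q \<otimes>\<^bsub>permutation_group P\<^esub> p = \<one>\<^bsub>permutation_group P\<^esub>"
    if "p \<in> carrier (permutation_group P)" for p
    using that by (intro bexI[of _ "Hilbert_Choice.inv p"]) (auto simp: permutes_inv permutes_inv_o)
qed (auto simp: permutes_compose permutes_id comp_assoc)

lemma finite_permutation_group: "finite P \<Longrightarrow> finite (carrier (permutation_group P))"
  by (simp add: permutation_group_def finite_permutations)

text \<open>
  M. Hall's theorem: each basis element is a partial injection on the finite set \<open>P\<close> of left cosets
  met while reading the words for \<open>Y\<close> and \<open>x\<close> from the right. Extending these partial injections to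
  permutations of \<open>P\<close> yields an action for which \<open>K\<close> fixes its own coset and \<open>x\<close> does not.
\<close>

lemma free_basis_separates:
  fixes F :: "('a, 'b) monoid_scheme"
  assumes "group F" "free_basis F S" "finite Y" "Y \<subseteq> carrier F"
    and "x \<in> carrier F" "x \<notin> generate F Y"
  obtains Q :: "('a set \<Rightarrow> 'a set) monoid" and \<phi>
  where "group Q" "finite (carrier Q)" "\<phi> \<in> hom F Q" "\<phi> x \<notin> \<phi> ` generate F Y"
proof -
  interpret F: group F by fact
  have S: "S \<subseteq> carrier F" and bij: "bij_betw (word_value F) (reduced_words S) (carrier F)"
    using assms(2) by (auto simp: free_basis_def)
  define K where "K = generate F Y"
  have K: "subgroup K F"
    unfolding K_def by (rule F.generate_is_subgroup) fact
  then have KF: "K \<subseteq> carrier F" by (rule subgroup.subset)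
  define r where "r = inv_into (reduced_words S) (word_value F)"
  have r: "r z \<in> reduced_words S" "word_value F (r z) = z" if "z \<in> carrier F" for z
    using that bij by (auto simp: r_def bij_betw_def inv_into_into f_inv_into_f)
  \<comment> \<open>The empty suffix contributes \<open>K\<close> itself, and the full words
    contribute the cosets of \<open>x\<close> and of the elements of \<open>Y\<close>.\<close>
  define P where "P = (\<lambda>v. word_value F v <#\<^bsub>F\<^esub> K) ` (\<Union>z\<in>insert x Y. set (suffixes (r z)))"
  have fP: "finite P" unfolding P_def using assms(3) by auto
  have suf: "suffix v (r z) \<Longrightarrow> fst ` set v \<subseteq> carrier F" if "z \<in> carrier F" for v z
  proof -
    assume "suffix v (r z)"
    then have "set v \<subseteq> set (r z)" by (rule set_mono_suffix)
    then have "set v \<subseteq> S \<times> UNIV" using r(1)[OF that] by (auto simp: reduced_words_def)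
    then show "fst ` set v \<subseteq> carrier F" using S by fastforce
  qed
  then have PF: "c \<subseteq> carrier F" if "c \<in> P" for c
  proof -
    obtain v z where "z \<in> insert x Y" "suffix v (r z)" and c: "c = word_value F v <#\<^bsub>F\<^esub> K"
      using \<open>c \<in> P\<close> unfolding P_def in_set_suffixes[symmetric] by blast
    then have "fst ` set v \<subseteq> carrier F" using suf[of z v] assms(4,5) by auto
    then show ?thesis
      unfolding c by (intro F.l_coset_subset_G KF F.word_value_closed)
  qed
  have "\<exists>p. p permutes P \<and> (\<forall>c\<in>P. s <#\<^bsub>F\<^esub> c \<in> P \<longrightarrow> p c = s <#\<^bsub>F\<^esub> c)" if "s \<in> S" for s
  proof -
    have s: "s \<in> carrier F" using that S by blast
    \<comment> \<open>The domain of the partial injection: the cosets in \<open>P\<close> that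
      translation by \<open>s\<close> keeps in \<open>P\<close>.\<close>
    let ?A = "{c \<in> P. s <#\<^bsub>F\<^esub> c \<in> P}"
    have "inj_on ((<#\<^bsub>F\<^esub>) s) ?A"
    proof (rule inj_on_inverseI)
      fix c assume "c \<in> ?A"
      then show "inv\<^bsub>F\<^esub> s <#\<^bsub>F\<^esub> (s <#\<^bsub>F\<^esub> c) = c"
        using s PF[of c] by (simp add: F.lcos_m_assoc F.lcos_mult_one)
    qed
    then obtain p where "p permutes P" "\<And>c. c \<in> ?A \<Longrightarrow> p c = s <#\<^bsub>F\<^esub> c"
      using partial_injection_extends_to_permutation[OF fP, of ?A "(<#\<^bsub>F\<^esub>) s"] by auto
    then show ?thesis by auto
  qed
  then obtain \<pi> where \<pi>: "\<And>s. s \<in> S \<Longrightarrow> \<pi> s permutes P"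
    "\<And>s c. s \<in> S \<Longrightarrow> c \<in> P \<Longrightarrow> s <#\<^bsub>F\<^esub> c \<in> P \<Longrightarrow> \<pi> s c = s <#\<^bsub>F\<^esub> c"
    by metis
  obtain \<phi> where \<phi>: "\<phi> \<in> hom F (permutation_group P)" "\<And>s. s \<in> S \<Longrightarrow> \<phi> s = \<pi> s"
  proof (rule free_basis_hom[OF assms(1,2) group_permutation_group])
    show "\<pi> ` S \<subseteq> carrier (permutation_group P)" using \<pi>(1) by auto
  qed (rule that)
  interpret group_hom F "permutation_group P" \<phi>
    using assms(1) group_permutation_group \<phi>(1) by (simp add: group_hom_def group_hom_axioms_def)
  have inv_fix: "\<phi> (inv\<^bsub>F\<^esub> g) d = c" if g: "g \<in> carrier F" and "\<phi> g c = d" for g c d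
  proof -
    have "\<phi> (inv\<^bsub>F\<^esub> g) \<circ> \<phi> g = id"
      using hom_mult[of "inv\<^bsub>F\<^esub> g" g] g hom_one by simp
    then show ?thesis using that(2) by (metis comp_apply id_apply)
  qed
  have letter: "\<phi> (letter_value F l) c = letter_value F l <#\<^bsub>F\<^esub> c"
    if l: "fst l \<in> S" and c: "c \<in> P" "letter_value F l <#\<^bsub>F\<^esub> c \<in> P" for l c
  proof (cases l)
    case (Pair s b)
    then have s: "s \<in> S" "s \<in> carrier F" using l S by auto
    show ?thesis
    proof (cases b)
      case True
      then show ?thesis using Pair c s \<phi>(2) \<pi>(2) by simp
    next
      case False
      \<comment> \<open>An inverse letter follows an edge backwards: \<open>\<pi> s\<close> sends
        \<open>?d\<close> to \<open>c\<close>, so the inverse permutation sends \<open>c\<close> to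
        \<open>?d\<close>.\<close>
      let ?d = "inv\<^bsub>F\<^esub> s <#\<^bsub>F\<^esub> c"
      have d: "s <#\<^bsub>F\<^esub> ?d = c"
        using s PF[OF c(1)] by (simp add: F.lcos_m_assoc F.lcos_mult_one)
      have "\<phi> s ?d = c"
        using Pair False c s \<phi>(2) \<pi>(2)[of s ?d] d by simp
      then show ?thesis
        using Pair False inv_fix s by simp
    qed
  qed
  \<comment> \<open>As long as every suffix leads to a coset in \<open>P\<close>, each letter acts
    by true translation and not by the arbitrary part of its permutation.\<close>
  have act: "\<phi> (word_value F w) K = word_value F w <#\<^bsub>F\<^esub> K"
    if "set w \<subseteq> S \<times> UNIV" "\<And>v. suffix v w \<Longrightarrow> word_value F v <#\<^bsub>F\<^esub> K \<in> P" for w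
    using that
  proof (induction w)
    case Nil
    then show ?case using KF hom_one by (simp add: F.lcos_mult_one)
  next
    case (Cons l w)
    have l: "fst l \<in> S" and lF: "letter_value F l \<in> carrier F" using Cons.prems(1) S by auto
    have wF: "word_value F w \<in> carrier F"
      using Cons.prems(1) S by (intro F.word_value_closed) auto
    let ?c = "word_value F w <#\<^bsub>F\<^esub> K"
    have "?c \<in> P" using Cons.prems(2)[of w] by (simp add: suffix_ConsI)
    moreover have eq: "letter_value F l <#\<^bsub>F\<^esub> ?c = word_value F (l # w) <#\<^bsub>F\<^esub> K"
      using lF wF KF by (simp add: F.lcos_m_assoc)
    moreover have "word_value F (l # w) <#\<^bsub>F\<^esub> K \<in> P"
      by (rule Cons.prems(2)) simp
    moreover have "\<phi> (word_value F w) K = ?c"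
      using Cons.prems by (intro Cons.IH) (auto simp: suffix_ConsI)
    ultimately show ?case
      using letter[OF l, of ?c] hom_mult[OF lF wF] by simp
  qed
  have act': "\<phi> z K = z <#\<^bsub>F\<^esub> K" if z: "z \<in> insert x Y" for z
  proof -
    have zF: "z \<in> carrier F" using z assms(4,5) by auto
    have "\<phi> (word_value F (r z)) K = word_value F (r z) <#\<^bsub>F\<^esub> K"
    proof (rule act)
      show "set (r z) \<subseteq> S \<times> UNIV" using r(1)[OF zF] by (simp add: reduced_words_def)
      show "word_value F v <#\<^bsub>F\<^esub> K \<in> P" if "suffix v (r z)" for v
        using that z unfolding P_def in_set_suffixes[symmetric] by blast
    qed
    then show ?thesis using r(2)[OF zF] by simp
  qed
  \<comment> \<open>Only the generators in \<open>Y\<close> have their paths inside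
    \<open>P\<close>; the rest of \<open>K\<close> fixes the coset because stabilisers are closed
    under products and inverses.\<close>
  have stab: "\<phi> k K = K" if "k \<in> K" for k
    using that[unfolded K_def]
  proof (induction k rule: generate.induct)
    case one
    then show ?case using hom_one by simp
  next
    case (incl h)
    then have "h \<in> K" by (simp add: K_def generate.incl)
    then show ?case using act'[of h] incl F.coset_join3[OF _ K, of h] KF by auto
  next
    case (inv h)
    then have "h \<in> K" by (simp add: K_def generate.incl)
    then have "\<phi> h K = K" using act'[of h] inv F.coset_join3[OF _ K, of h] KF by auto
    then show ?case using inv assms(4) inv_fix by blast
  next
    case (eng h1 h2)
    then show ?case using hom_mult F.generate_in_carrier[OF assms(4)] by simp
  qed
  have "\<phi> x K \<noteq> K"
  proof
    assume "\<phi> x K = K"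
    then have "x <#\<^bsub>F\<^esub> K = K" using act'[of x] by simp
    moreover have "x \<in> x <#\<^bsub>F\<^esub> K"
      using subgroup.one_closed[OF K] assms(5) unfolding l_coset_def by force
    ultimately show False using assms(6) K_def by simp
  qed
  then have "\<phi> x \<notin> \<phi> ` K" using stab by auto
  then show ?thesis
    using that[OF group_permutation_group finite_permutation_group[OF fP] \<phi>(1)] K_def by simp
qed

section \<open>Conjugation of subgroups and the case of free groups\<close>

lemma conjugate_set_mono: "A \<subseteq> B \<Longrightarrow> conjugate_set G A g \<subseteq> conjugate_set G B g"
  unfolding conjugate_set_eq by (rule image_mono)

lemma (in group) inj_on_conjugate:
  "g \<in> carrier G \<Longrightarrow> inj_on (\<lambda>a. inv g \<otimes> (a \<otimes> g)) (carrier G)"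
  by (rule inj_onI) simp

lemma (in group) conjugate_set_mult:
  assumes "A \<subseteq> carrier G" "g \<in> carrier G" "h \<in> carrier G"
  shows "conjugate_set G A (g \<otimes> h) = conjugate_set G (conjugate_set G A g) h"
  unfolding conjugate_set_eq image_image
  using assms by (intro image_cong) (auto simp: m_assoc inv_mult_group subset_iff)

lemma (in group) conjugate_set_one: "A \<subseteq> carrier G \<Longrightarrow> conjugate_set G A \<one> = A"
  unfolding conjugate_set_eq by (auto simp: subset_iff image_iff)

lemma (in group) subgroup_conjugate_set_self:
  assumes "subgroup H G" "h \<in> H"
  shows "conjugate_set G H h \<subseteq> H"
  using assms unfolding conjugate_set_eq by (auto simp: subgroup.m_closed subgroup.m_inv_closed)

text \<open>An element x of K outside K^t is the conjugate by \<open>t\<close> of some y outside K,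
  which a finite quotient separates from K. There the image of K has as many elements as its
  conjugate, so the two agree; undoing the conjugation of the image of x puts the image of y into
  that of K, a contradiction.\<close>

lemma free_basis_conjugate_into_self:
  assumes "group F" "free_basis F S" "finite Y" "Y \<subseteq> carrier F" "t \<in> carrier F"
    and sub: "conjugate_set F (generate F Y) t \<subseteq> generate F Y"
  shows "conjugate_set F (generate F Y) t = generate F Y"
proof (rule ccontr)
  interpret F: group F by fact
  let ?K = "generate F Y"
  have KF: "?K \<subseteq> carrier F" using assms(4) by (rule F.generate_incl)
  assume "conjugate_set F ?K t \<noteq> ?K"
  then obtain x where x: "x \<in> ?K" "x \<notin> conjugate_set F ?K t" using sub by blast
  define y where "y = t \<otimes>\<^bsub>F\<^esub> x \<otimes>\<^bsub>F\<^esub> inv\<^bsub>F\<^esub> t"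
  have xF: "x \<in> carrier F" and y: "y \<in> carrier F" using x KF assms(5) by (auto simp: y_def)
  have xy: "x = inv\<^bsub>F\<^esub> t \<otimes>\<^bsub>F\<^esub> (y \<otimes>\<^bsub>F\<^esub> t)"
    using xF assms(5) by (simp add: y_def F.m_assoc F.mult_inv_cancel_left)
  then have "y \<notin> ?K" using x(2) unfolding conjugate_set_eq by blast
  then obtain Q :: "('a set \<Rightarrow> 'a set) monoid" and \<phi> where Q: "group Q" "finite (carrier Q)"
    and \<phi>: "\<phi> \<in> hom F Q" "\<phi> y \<notin> \<phi> ` ?K"
    using free_basis_separates[OF assms(1-4) y] by metis
  interpret group_hom F Q \<phi>
    using assms(1) Q \<phi>(1) by (simp add: group_hom_def group_hom_axioms_def)
  have KQ: "\<phi> ` ?K \<subseteq> carrier Q" using KF by auto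
  then have fin: "finite (\<phi> ` ?K)" using Q(2) by (rule finite_subset)
  have t: "\<phi> t \<in> carrier Q" using assms(5) by simp
  have "conjugate_set Q (\<phi> ` ?K) (\<phi> t) = \<phi> ` conjugate_set F ?K t"
    using assms(1) Q(1) \<phi>(1) KF assms(5) by (rule conjugate_set_hom)
  then have "conjugate_set Q (\<phi> ` ?K) (\<phi> t) \<subseteq> \<phi> ` ?K" using sub by auto
  moreover have "card (conjugate_set Q (\<phi> ` ?K) (\<phi> t)) = card (\<phi> ` ?K)"
    unfolding conjugate_set_eq
    using KQ by (intro card_image inj_on_subset[OF H.inj_on_conjugate[OF t]])
  ultimately have "conjugate_set Q (\<phi> ` ?K) (\<phi> t) = \<phi> ` ?K"
    using fin by (simp add: card_subset_eq)
  then have "\<phi> x \<in> conjugate_set Q (\<phi> ` ?K) (\<phi> t)" using x(1) by blast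
  then obtain k where k: "k \<in> \<phi> ` ?K" "\<phi> x = inv\<^bsub>Q\<^esub> \<phi> t \<otimes>\<^bsub>Q\<^esub> (k \<otimes>\<^bsub>Q\<^esub> \<phi> t)"
    unfolding conjugate_set_eq by (rule imageE)
  have "\<phi> x = inv\<^bsub>Q\<^esub> \<phi> t \<otimes>\<^bsub>Q\<^esub> (\<phi> y \<otimes>\<^bsub>Q\<^esub> \<phi> t)"
    unfolding xy using y assms(5) by simp
  then have "\<phi> y = k"
    using inj_onD[OF H.inj_on_conjugate[OF t], of "\<phi> y" k] k y KQ hom_closed by force
  then show False using k(1) \<phi>(2) by simp
qed


section \<open>Passage to finite extensions\<close>

lemma (in group) rcos_eq_imp_mem:
  assumes "subgroup K G" "a \<in> carrier G" "b \<in> carrier G" "K #> a = K #> b"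
  shows "a \<otimes> inv b \<in> K"
  using subgroup.rcos_module_imp[OF assms(1) is_group assms(3), of a]
    rcos_self[OF assms(2,1)] assms(4) by simp

text \<open>
  Schreier's generators: \<open>\<rho>\<close> picks a transversal \<open>T\<close> containing \<open>\<one>\<close>, and \<open>\<langle>Y\<rangle> T\<close> is closed under right
  multiplication by the generators and their inverses.
\<close>

lemma (in group) finite_index_subgroup_finitely_generated:
  assumes K: "subgroup K G" and S: "S \<subseteq> carrier G" "finite S"
    and KH: "K \<subseteq> generate G S" and fin: "finite ((#>) K ` generate G S)"
  obtains Y where "finite Y" "Y \<subseteq> K" "K = generate G Y"
proof -
  let ?H = "generate G S"
  have H: "subgroup ?H G" using S(1) by (rule generate_is_subgroup)
  note HG = subgroup.mem_carrier[OF H] and KG = subgroup.mem_carrier[OF K]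
  \<comment> \<open>The value \<open>\<one>\<close> at the trivial coset matters: it puts
    \<open>\<one>\<close> into \<open>T\<close>, and at the end it forces a representative lying in
    \<open>K\<close> to be \<open>\<one>\<close>.\<close>
  define \<rho> where "\<rho> = (\<lambda>C. if C = K then \<one> else SOME h. h \<in> ?H \<and> K #> h = C)"
  have \<rho>: "\<rho> (K #> h) \<in> ?H" "K #> \<rho> (K #> h) = K #> h" if "h \<in> ?H" for h
  proof -
    have "\<rho> (K #> h) \<in> ?H \<and> K #> \<rho> (K #> h) = K #> h"
    proof (cases "K #> h = K")
      case True
      then show ?thesis
        using subgroup.subset[OF K] by (simp add: \<rho>_def generate.one)
    next
      case False
      then show ?thesis
        using that someI[of "\<lambda>h'. h' \<in> ?H \<and> K #> h' = K #> h" h] by (simp add: \<rho>_def)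
    qed
    then show "\<rho> (K #> h) \<in> ?H" "K #> \<rho> (K #> h) = K #> h" by auto
  qed
  define T where "T = \<rho> ` (#>) K ` ?H"
  have TH: "T \<subseteq> ?H" using \<rho> by (auto simp: T_def)
  have T1: "\<one> \<in> T"
  proof -
    have "\<rho> (K #> \<one>) = \<one>" using subgroup.subset[OF K] by (simp add: \<rho>_def)
    then show ?thesis unfolding T_def by (metis generate.one image_eqI)
  qed
  define S' where "S' = S \<union> (\<lambda>s. inv s) ` S"
  have S'H: "S' \<subseteq> ?H" by (auto simp: S'_def generate.incl generate.inv)
  \<comment> \<open>All products t s u^-1 that fall into \<open>K\<close>, with u ranging over the
    whole of \<open>T\<close>; finiteness is then immediate, and Schreier's choice, u the
    representative of the coset of t s, is among them.\<close>
  define Y where "Y = K \<inter> (\<lambda>(t, s, u). t \<otimes> s \<otimes> inv u) ` (T \<times> S' \<times> T)"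
  let ?Y = "generate G Y"
  have YK: "Y \<subseteq> K" by (auto simp: Y_def)
  have finY: "finite Y" using fin S(2) by (auto simp: Y_def T_def S'_def)
  have YK': "?Y \<subseteq> K" using YK K by (rule generate_subgroup_incl)
  have step: "\<exists>y'\<in>?Y. \<exists>t'\<in>T. y \<otimes> t \<otimes> s = y' \<otimes> t'"
    if y: "y \<in> ?Y" and t: "t \<in> T" and s: "s \<in> S'" for y t s
  proof -
    have ts: "t \<otimes> s \<in> ?H" using t s TH S'H subgroup.m_closed[OF H] by blast
    define u where "u = \<rho> (K #> (t \<otimes> s))"
    have u: "u \<in> T" "u \<in> ?H" using \<rho>(1)[OF ts] ts by (auto simp: u_def T_def)
    have "t \<otimes> s \<otimes> inv u \<in> K"
      using \<rho>(2)[OF ts] HG[OF ts] HG[OF u(2)] by (intro rcos_eq_imp_mem[OF K]) (auto simp: u_def)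
    then have "t \<otimes> s \<otimes> inv u \<in> Y" using t s u(1) by (force simp: Y_def)
    then have "y \<otimes> (t \<otimes> s \<otimes> inv u) \<in> ?Y" using y by (blast intro: generate.eng generate.incl)
    moreover have "y \<otimes> t \<otimes> s = y \<otimes> (t \<otimes> s \<otimes> inv u) \<otimes> u"
    proof -
      have "y \<in> carrier G" "t \<in> carrier G" "s \<in> carrier G" "u \<in> carrier G"
        using y YK' KG t TH s S'H u HG by blast+
      then show ?thesis by (simp add: m_assoc)
    qed
    ultimately show ?thesis using u(1) by blast
  qed
  \<comment> \<open>\<open>y\<close> and \<open>t\<close> stay arbitrary, so that in a product
    \<open>h1 \<otimes> h2\<close> the second factor can start from the pair produced by the
    first.\<close>
  have cover: "\<exists>y'\<in>?Y. \<exists>t'\<in>T. y \<otimes> t \<otimes> h = y' \<otimes> t'"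
    if "h \<in> ?H" "y \<in> ?Y" "t \<in> T" for h y t
    using that
  proof (induction h arbitrary: y t rule: generate.induct)
    case one
    have "y \<in> carrier G" "t \<in> carrier G" using one YK' KG TH HG by blast+
    then show ?case using one by (metis m_closed r_one)
  next
    case (incl h)
    then show ?case by (intro step) (auto simp: S'_def)
  next
    case (inv h)
    then show ?case by (intro step) (auto simp: S'_def)
  next
    case (eng h1 h2)
    have c: "y \<in> carrier G" "t \<in> carrier G" "h1 \<in> carrier G" "h2 \<in> carrier G"
      using eng.prems eng.hyps YK' KG TH HG by blast+
    obtain y1 t1 where 1: "y1 \<in> ?Y" "t1 \<in> T" "y \<otimes> t \<otimes> h1 = y1 \<otimes> t1"
      using eng.IH(1)[OF eng.prems] by blast
    obtain y2 t2 where "y2 \<in> ?Y" "t2 \<in> T" "y1 \<otimes> t1 \<otimes> h2 = y2 \<otimes> t2"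
      using eng.IH(2)[OF 1(1,2)] by blast
    moreover have "y \<otimes> t \<otimes> (h1 \<otimes> h2) = y1 \<otimes> t1 \<otimes> h2"
      using c 1(3)[symmetric] by (simp add: m_assoc)
    ultimately show ?case by metis
  qed
  \<comment> \<open>Starting from \<open>\<one>\<close>, write h = y t. Both h and y lie in
    \<open>K\<close>, so t does too, and the only representative in \<open>K\<close> is
    \<open>\<one>\<close>.\<close>
  have "h \<in> ?Y" if h: "h \<in> K" for h
  proof -
    have hG: "h \<in> carrier G" using KG h .
    obtain y t where yt: "y \<in> ?Y" "t \<in> T" "\<one> \<otimes> \<one> \<otimes> h = y \<otimes> t"
      using cover[of h \<one> \<one>] h KH T1 generate.one by blast
    have c: "y \<in> carrier G" "t \<in> carrier G" using yt YK' KG TH HG by blast+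
    have "t = inv y \<otimes> h" using yt(3) c hG by (simp add: inv_solve_left)
    then have "t \<in> K"
      using yt(1) YK' h K by (auto intro: subgroup.m_closed subgroup.m_inv_closed)
    then have Kt: "K #> t = K" using c(2) K by (intro coset_join2)
    obtain g where "g \<in> ?H" "t = \<rho> (K #> g)" using yt(2) by (auto simp: T_def)
    then have "t = \<rho> K" using \<rho>(2)[of g] Kt by simp
    then have "t = \<one>" by (simp add: \<rho>_def)
    then show ?thesis using yt c hG by simp
  qed
  then have "K = ?Y" using YK' by blast
  then show ?thesis using that[OF finY YK] by blast
qed

text \<open>
  Conjugation by \<open>t\<close> injects the finite set of cosets of \<open>K\<close> in \<open>H\<close> into itself, so it is onto.
\<close>

lemma (in group) finite_index_conjugate_eq:
  assumes K: "subgroup K G" and H: "subgroup H G" and fin: "finite ((#>) K ` H)"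
    and t: "t \<in> carrier G" and Kt: "conjugate_set G K t = K" and Ht: "conjugate_set G H t \<subseteq> H"
    and KH: "K \<subseteq> H"
  shows "conjugate_set G H t = H"
proof -
  define \<alpha> where "\<alpha> = (\<lambda>a. inv t \<otimes> (a \<otimes> t))"
  have conj: "conjugate_set G A t = \<alpha> ` A" for A by (simp add: conjugate_set_eq \<alpha>_def)
  note HG = subgroup.subset[OF H] and KG = subgroup.subset[OF K]
  have \<alpha>_mult: "\<alpha> (a \<otimes> b) = \<alpha> a \<otimes> \<alpha> b" if "a \<in> carrier G" "b \<in> carrier G" for a b
    using that t by (simp add: \<alpha>_def m_assoc mult_inv_cancel_left)
  \<comment> \<open>Conjugation permutes cosets of \<open>K\<close> because it maps \<open>K\<close>
    onto itself.\<close>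
  have coset: "\<alpha> ` (K #> h) = K #> \<alpha> h" if h: "h \<in> H" for h
  proof -
    have "\<alpha> ` (K #> h) = (\<lambda>k. \<alpha> k \<otimes> \<alpha> h) ` K"
      using h HG KG \<alpha>_mult by (auto simp: r_coset_def image_iff subset_iff)
    also have "\<dots> = (\<lambda>k. k \<otimes> \<alpha> h) ` \<alpha> ` K" by (simp add: image_image)
    also have "\<dots> = K #> \<alpha> h" using Kt conj by (auto simp: r_coset_def)
    finally show ?thesis .
  qed
  have "inj_on ((`) \<alpha>) ((#>) K ` H)"
  proof (rule inj_on_subset)
    show "inj_on ((`) \<alpha>) (Pow (carrier G))"
      using inj_on_conjugate[OF t] unfolding \<alpha>_def by (rule inj_on_image_Pow)
    show "(#>) K ` H \<subseteq> Pow (carrier G)" using HG r_coset_subset_G[OF KG] by blast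
  qed
  moreover have "(`) \<alpha> ` (#>) K ` H \<subseteq> (#>) K ` H"
    using coset Ht conj by auto
  ultimately have surj: "(`) \<alpha> ` (#>) K ` H = (#>) K ` H"
    using fin by (simp add: endo_inj_surj)
  \<comment> \<open>Surjectivity on cosets passes to elements: the coset of h is the image of a
    coset that lies inside \<open>H\<close>, since \<open>K \<subseteq> H\<close>.\<close>
  have "h \<in> \<alpha> ` H" if h: "h \<in> H" for h
  proof -
    have "K #> h \<in> (`) \<alpha> ` (#>) K ` H" using surj h by blast
    then obtain h' where h': "h' \<in> H" "K #> h = \<alpha> ` (K #> h')" by blast
    have "K #> h' \<subseteq> H" using h'(1) KH H by (auto simp: r_coset_def intro: subgroup.m_closed)
    moreover have "h \<in> K #> h" using h HG K by (intro rcos_self) auto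
    ultimately show ?thesis using h'(2) by blast
  qed
  then show ?thesis using Ht conj by auto
qed

text \<open>Pigeonhole: two powers of \<open>g\<close> share a coset of \<open>F\<close>, and their
  quotient is a positive power of \<open>g\<close> in \<open>F\<close>.\<close>

lemma (in group) finite_index_power_mem:
  assumes F: "subgroup F G" and fin: "finite (rcosets F)" and g: "g \<in> carrier G"
  obtains n :: nat where "n > 0" "g [^] n \<in> F"
proof -
  have "range (\<lambda>n::nat. F #> g [^] n) \<subseteq> rcosets F"
    using g by (auto simp: RCOSETS_def)
  then have "\<not> inj (\<lambda>n::nat. F #> g [^] n)"
    using fin by (metis finite_imageD finite_subset infinite_UNIV_nat)
  then obtain m n where mn: "F #> g [^] m = F #> g [^] n" "m < (n::nat)"
    unfolding inj_def by (metis linorder_neqE_nat)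
  then have "g [^] n \<otimes> inv (g [^] m) \<in> F"
    using g by (intro rcos_eq_imp_mem[OF F]) auto
  moreover have "g [^] n = g [^] (n - m) \<otimes> g [^] m"
    using g mn(2) by (simp add: nat_pow_mult)
  ultimately have "g [^] (n - m) \<in> F" using g by (simp add: m_assoc)
  then show ?thesis using mn(2) that[of "n - m"] by simp
qed

lemma (in group) conjugate_set_pow_subset:
  assumes "subgroup H G" "g \<in> carrier G" "conjugate_set G H g \<subseteq> H"
  shows "conjugate_set G H (g [^] (n::nat)) \<subseteq> H"
proof (induction n)
  case 0
  then show ?case using conjugate_set_one[OF subgroup.subset[OF assms(1)]] by simp
next
  case (Suc n)
  have "conjugate_set G H (g [^] Suc n) = conjugate_set G (conjugate_set G H (g [^] n)) g"
    using conjugate_set_mult[OF subgroup.subset[OF assms(1)], of "g [^] n" g] assms(2) by simp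
  also have "\<dots> \<subseteq> conjugate_set G H g" using Suc by (rule conjugate_set_mono)
  finally show ?case using assms(3) by blast
qed

section \<open>Self-conjugacy in virtually free groups\<close>

lemma (in group) virtually_free_conjugate_into_self:
  assumes "virtually_free G" "fg_subgroup H G" "g \<in> carrier G" "conjugate_set G H g \<subseteq> H"
  shows "conjugate_set G H g = H"
proof -
  obtain F S where F: "subgroup F G" and fin: "finite (rcosets F)"
    and basis: "group (G\<lparr>carrier := F\<rparr>)" "free_basis (G\<lparr>carrier := F\<rparr>) S"
    using assms(1) by (auto simp: virtually_free_def free_group_def)
  obtain A where A: "A \<subseteq> carrier G" "finite A" "H = generate G A" and H: "subgroup H G"
    using assms(2) by (auto simp: fg_subgroup_def)
  note HG = subgroup.subset[OF H]
  obtain n where n: "n > 0" "g [^] (n::nat) \<in> F"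
    using finite_index_power_mem[OF F fin assms(3)] .
  define t where "t = g [^] n"
  have t: "t \<in> F" "t \<in> carrier G" using n(2) assms(3) by (auto simp: t_def)
  define K where "K = H \<inter> F"
  have K: "subgroup K G" unfolding K_def using H F by (rule subgroups_Inter_pair)
  \<comment> \<open>The cosets of \<open>K\<close> in \<open>H\<close> are traces on
    \<open>H\<close> of cosets of \<open>F\<close>, so there are finitely many.\<close>
  have coset: "K #> h = H \<inter> (F #> h)" if h: "h \<in> H" for h
  proof (intro equalityI subsetI)
    show "x \<in> H \<inter> (F #> h)" if "x \<in> K #> h" for x
      using that h H by (auto simp: K_def r_coset_def intro: subgroup.m_closed)
    show "x \<in> K #> h" if x: "x \<in> H \<inter> (F #> h)" for x
    proof -
      obtain f where f: "f \<in> F" "x = f \<otimes> h" using x by (auto simp: r_coset_def)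
      then have "f = x \<otimes> inv h"
        using h HG subgroup.mem_carrier[OF F] by (auto simp: m_assoc)
      then have "f \<in> H" using x h H by (auto intro: subgroup.m_closed subgroup.m_inv_closed)
      then show ?thesis using f by (auto simp: K_def r_coset_def)
    qed
  qed
  have "(#>) K ` H = (\<inter>) H ` (#>) F ` H"
    using coset by (simp add: image_image cong: image_cong)
  also have "\<dots> \<subseteq> (\<inter>) H ` (rcosets F)"
    using rcosetsI[OF subgroup.subset[OF F]] HG by (intro image_mono) auto
  finally have finK: "finite ((#>) K ` H)" by (rule finite_subset) (intro finite_imageI fin)
  have "K \<subseteq> generate G A" using A(3) by (auto simp: K_def)
  then obtain Y where Y: "finite Y" "Y \<subseteq> K" "K = generate G Y"
    using finite_index_subgroup_finitely_generated[OF K A(1,2)] finK A(3) by metis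
  have YF: "Y \<subseteq> F" using Y(2) by (auto simp: K_def)
  have gen: "generate (G\<lparr>carrier := F\<rparr>) Y = K"
    using generate_consistent[OF YF F] Y(3) by simp
  have conj: "conjugate_set (G\<lparr>carrier := F\<rparr>) K t = conjugate_set G K t"
    using m_inv_consistent[OF F t(1)] by (simp add: conjugate_set_eq)
  have Ht: "conjugate_set G H t \<subseteq> H"
    unfolding t_def using H assms(3,4) by (rule conjugate_set_pow_subset)
  moreover have "conjugate_set G F t \<subseteq> F" using F t(1) by (rule subgroup_conjugate_set_self)
  ultimately have "conjugate_set G K t \<subseteq> K"
    unfolding K_def using conjugate_set_mono[of "H \<inter> F"] by (metis inf_le1 inf_le2 le_inf_iff order_trans)
  then have "conjugate_set G K t = K"
    using free_basis_conjugate_into_self[OF basis Y(1), of t] YF t(1) gen conj by simp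
  then have "conjugate_set G H t = H"
    by (intro finite_index_conjugate_eq[OF K H finK t(2) _ Ht]) (auto simp: K_def)
  \<comment> \<open>Since n > 0, a last factor \<open>g\<close> can be split off: H^t is the
    conjugate by \<open>g\<close> of a subset of \<open>H\<close>. So H = H^t \<subseteq> H^g
    \<subseteq> H.\<close>
  moreover have "conjugate_set G H t \<subseteq> conjugate_set G H g"
  proof -
    obtain m where m: "n = Suc m" using n(1) gr0_implies_Suc by blast
    have "conjugate_set G H t = conjugate_set G (conjugate_set G H (g [^] m)) g"
      unfolding t_def m using conjugate_set_mult[OF HG, of "g [^] m" g] assms(3) by simp
    also have "\<dots> \<subseteq> conjugate_set G H g"
      using conjugate_set_pow_subset[OF H assms(3,4)] by (rule conjugate_set_mono)
    finally show ?thesis .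
  qed
  ultimately show ?thesis using assms(4) by blast
qed

section \<open>From into-conjugacy separability to conjugacy separability\<close>

theorem proposition1p7:
  fixes G :: "('a, 'b) monoid_scheme"
  assumes "group G"
    and "virtually_free G"
    and "SICS G"
  shows "SCS G"
  unfolding SCS_def
proof (intro allI impI)
  interpret group G by fact
  fix H1 H2
  assume fg: "fg_subgroup H1 G" "fg_subgroup H2 G" and nc: "\<not> conjugate_in G H1 H2"
  have HG: "H1 \<subseteq> carrier G" "H2 \<subseteq> carrier G"
    using fg by (auto simp: fg_subgroup_def subgroup.subset)
  have "\<not> (conjugate_into G H1 H2 \<and> conjugate_into G H2 H1)"
  proof
    assume "conjugate_into G H1 H2 \<and> conjugate_into G H2 H1"
    then obtain g h where g: "g \<in> carrier G" "conjugate_set G H1 g \<subseteq> H2"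
      and h: "h \<in> carrier G" "conjugate_set G H2 h \<subseteq> H1"
      by (auto simp: conjugate_into_def)
    \<comment> \<open>The chain is H2^(hg) \<subseteq> H1^g \<subseteq> H2; its ends coincide, which
      makes \<open>H1\<close> and \<open>H2\<close> conjugate.\<close>
    have "conjugate_set G H2 (h \<otimes>\<^bsub>G\<^esub> g) \<subseteq> conjugate_set G H1 g"
      using conjugate_set_mult[OF HG(2) h(1) g(1)] conjugate_set_mono[OF h(2)] by simp
    moreover from this have "conjugate_set G H2 (h \<otimes>\<^bsub>G\<^esub> g) = H2"
      using g h by (intro virtually_free_conjugate_into_self[OF assms(2) fg(2)]) auto
    ultimately have "conjugate_set G H1 g = H2" using g(2) by blast
    then show False using nc g(1) by (auto simp: conjugate_in_def)
  qed
  then show "\<exists>(Q :: nat monoid) \<phi>. group Q \<and> finite (carrier Q) \<and> \<phi> \<in> hom G Q \<and>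
      \<not> conjugate_in Q (\<phi> ` H1) (\<phi> ` H2)"
  proof (elim de_Morgan_conj[THEN iffD1, THEN disjE])
    assume "\<not> conjugate_into G H1 H2"
    then obtain Q :: "nat monoid" and \<phi> where "group Q" "finite (carrier Q)" "\<phi> \<in> hom G Q"
      "\<not> conjugate_into Q (\<phi> ` H1) (\<phi> ` H2)"
      using assms(3) fg unfolding SICS_def by blast
    then show ?thesis unfolding conjugate_in_def conjugate_into_def by blast
  next
    assume "\<not> conjugate_into G H2 H1"
    then obtain Q :: "nat monoid" and \<phi> where Q: "group Q" "finite (carrier Q)" "\<phi> \<in> hom G Q"
      and ni: "\<not> conjugate_into Q (\<phi> ` H2) (\<phi> ` H1)"
      using assms(3) fg unfolding SICS_def by blast
    interpret Q: group Q by fact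
    have "\<phi> ` H1 \<subseteq> carrier Q" using Q(3) HG(1) by (auto simp: hom_def)
    \<comment> \<open>Here the quotient separates in the opposite direction, so a conjugacy from the
      image of \<open>H1\<close> to that of \<open>H2\<close> has to be reversed by the inverse
      element.\<close>
    then have "conjugate_set Q (conjugate_set Q (\<phi> ` H1) q) (inv\<^bsub>Q\<^esub> q) = \<phi> ` H1"
      if "q \<in> carrier Q" for q
      using that by (simp add: Q.conjugate_set_mult[symmetric] Q.conjugate_set_one)
    then have "\<not> conjugate_in Q (\<phi> ` H1) (\<phi> ` H2)"
      using ni unfolding conjugate_in_def conjugate_into_def by (metis Q.inv_closed subset_refl)
    then show ?thesis using Q by blast
  qed
qed

end
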